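(* Let $\lambda>0$, let $\mathcal I\subset\mathbb Z^d$ be a finite multi-index set with Fourier weights $\hat{\boldsymbol W}=\operatorname{diag}(\hat w_{\boldsymbol n})_{\boldsymbol n\in\mathcal I}$, and let $\mathcal X\subset\mathbb T^d$ be a finite set of nodes with weights $\boldsymbol W=\operatorname{diag}(w_{\boldsymbol x})_{\boldsymbol x\in\mathcal X}$ such that $(\mathcal X,\boldsymbol W)$ forms a quadrature rule which is exact for all trigonometric exponentials $\mathrm e^{2\pi\mathrm i\boldsymbol n\cdot(\,\cdot\,)}$ with frequencies $\boldsymbol n$ in the difference set $\mathcal D(\mathcal I)=\{\boldsymbol n_1-\boldsymbol n_2:\boldsymbol n_1,\boldsymbol n_2\in\mathcal I\}$. Let $\boldsymbol F=(\mathrm e^{2\pi\mathrm i\boldsymbol n\cdot\boldsymbol x})_{\boldsymbol x\in\mathcal X,\boldsymbol n\in\mathcal I}$ and $\boldsymbol A=\boldsymbol F^{\mathsf H}\boldsymbol W\boldsymbol F+\lambda\hat{\boldsymbol W}$. Then: (i) the inverse of $\boldsymbol A$ is $$\boldsymbol A^{-1}=\left(\boldsymbol F^{\mathsf H}\boldsymbol W\boldsymbol F+\lambda\hat{\boldsymbol W}\right)^{-1}=\operatorname{diag}\left(\frac1{1+\lambda\hat w_{\boldsymbol n}}\right)_{\boldsymbol n\in\mathcal I};$$ (ii) for each $\boldsymbol x\in\mathcal X$ the diagonal entry corresponding to $\boldsymbol x$ of the hat matrix $\boldsymbol H=\boldsymbol F\boldsymbol A^{-1}\boldsymbol F^{\mathsf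 H}\boldsymbol W$ is $$h_{\boldsymbol x,\boldsymbol x}=w_{\boldsymbol x}\sum_{\boldsymbol n\in\mathcal I}\frac1{1+\lambda\hat w_{\boldsymbol n}}.$$
   Context: $\mathbb T^d=\mathbb R^d/\mathbb Z^d$ is the $d$-dimensional torus with Lebesgue measure of total mass $1$; $\boldsymbol n\cdot\boldsymbol x$ is the Euclidean inner product; $^{\mathsf H}$ denotes conjugate transpose. The weights $w_{\boldsymbol x}$ and $\hat w_{\boldsymbol n}$ are strictly positive real numbers. A set of nodes $\mathcal X\subset\mathcal M$ with weights $\boldsymbol W=\operatorname{diag}(w_{\boldsymbol x})_{\boldsymbol x\in\mathcal X}$ in a measure space $(\mathcal M,\mu)$ is an exact quadrature rule for a set $\mathcal P\subset L_1(\mathcal M)$ if $\sum_{\boldsymbol x\in\mathcal X}w_{\boldsymbol x}f(\boldsymbol x)=\int_{\mathcal M}f\,\mathrm d\mu$ for all $f\in\mathcal P$. *)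

theory Defs
  imports "HOL-Analysis.Analysis" "HOL-Probability.Probability_Measure"
    "Jordan_Normal_Form.Gauss_Jordan_Elimination" "Jordan_Normal_Form.Schur_Decomposition"
begin

section \<open>The torus\<close>

quotient_type (overloaded) 'd torus = "real ^ 'd::finite" /
  "\<lambda>x y. \<forall>i. vec_nth x i - vec_nth y i \<in> \<int>"
proof (intro equivpI reflpI sympI transpI)
  fix x y :: "real ^ 'd" assume xy: "\<forall>i. vec_nth x i - vec_nth y i \<in> \<int>"
  show "\<forall>i. vec_nth y i - vec_nth x i \<in> \<int>"
  proof
    fix i
    show "vec_nth y i - vec_nth x i \<in> \<int>"
      using Ints_minus[OF xy[rule_format, of i]] by simp
  qed
next
  fix x y z :: "real ^ 'd"
  assume xy: "\<forall>i. vec_nth x i - vec_nth y i \<in> \<int>"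
    and yz: "\<forall>i. vec_nth y i - vec_nth z i \<in> \<int>"
  show "\<forall>i. vec_nth x i - vec_nth z i \<in> \<int>"
  proof
    fix i
    show "vec_nth x i - vec_nth z i \<in> \<int>"
      using Ints_add[OF xy[rule_format, of i] yz[rule_format, of i]] by simp
  qed
qed simp

text \<open>The quotient topology.\<close>

instantiation torus :: (finite) topological_space
begin

definition open_torus :: "'a torus set \<Rightarrow> bool" where
  "open_torus U \<longleftrightarrow> open (abs_torus -` U)"

instance
  by standard (auto simp: open_torus_def vimage_Union)

end

lemma continuous_abs_torus: "continuous_on UNIV abs_torus"
  by (simp add: continuous_on_open_vimage open_torus_def)

lemma abs_torus_measurable [measurable]: "abs_torus \<in> borel_measurable borel"
  by (rule borel_measurable_continuous_onI[OF continuous_abs_torus])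

definition unit_cube :: "(real ^ 'd::finite) set" where
  "unit_cube = {x. \<forall>i. 0 \<le> vec_nth x i \<and> vec_nth x i < 1}"

text \<open>Lebesgue measure on the torus is the image of Lebesgue measure on the half-open unit
  cube, which is a fundamental domain for the quotient map.\<close>

definition torus_measure :: "'d::finite torus measure" where
  "torus_measure = distr (restrict_space lborel unit_cube) borel abs_torus"

lemma unit_cube_borel [measurable]: "unit_cube \<in> sets borel"
proof -
  have "unit_cube = (\<Inter>i. {x :: real ^ 'd. 0 \<le> vec_nth x i} \<inter> {x. vec_nth x i < 1})"
    by (auto simp: unit_cube_def)
  also have "\<dots> \<in> sets borel"
    by (intro sets.countable_INT' sets.Int borel_closed borel_open closed_Collect_le
        open_Collect_less continuous_intros) auto
  finally show ?thesis .
qed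

lemma emeasure_unit_cube: "emeasure lborel (unit_cube :: (real ^ 'd::finite) set) = 1"
proof (rule antisym)
  have 1: "emeasure lborel (cbox 0 (1 :: real ^ 'd)) = 1"
    by (subst emeasure_lborel_cbox)
      (auto simp: Basis_vec_def inner_axis one_vec_def intro!: prod.neutral)
  have 2: "emeasure lborel (box 0 (1 :: real ^ 'd)) = 1"
    by (subst emeasure_lborel_box)
      (auto simp: Basis_vec_def inner_axis one_vec_def intro!: prod.neutral)
  have "unit_cube \<subseteq> cbox 0 (1 :: real ^ 'd)"
    by (auto simp: unit_cube_def mem_box_cart less_imp_le)
  then show "emeasure lborel (unit_cube :: (real ^ 'd) set) \<le> 1"
    using emeasure_mono[of unit_cube "cbox 0 (1 :: real ^ 'd)" lborel] 1 by simp
  have "box 0 (1 :: real ^ 'd) \<subseteq> unit_cube"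
    by (auto simp: unit_cube_def mem_box_cart less_imp_le)
  then show "1 \<le> emeasure lborel (unit_cube :: (real ^ 'd) set)"
    using emeasure_mono[of "box 0 (1 :: real ^ 'd)" unit_cube lborel] 2 by simp
qed

lemma prob_space_torus_measure: "prob_space torus_measure"
  unfolding torus_measure_def
proof (rule prob_space.prob_space_distr)
  show "prob_space (restrict_space lborel (unit_cube :: (real ^ 'd) set))"
    by (rule prob_spaceI) (simp add: emeasure_restrict_space space_restrict_space emeasure_unit_cube)
  show "abs_torus \<in> restrict_space lborel unit_cube \<rightarrow>\<^sub>M borel"
    by (intro measurable_restrict_space1) simp
qed

lift_definition torus_exp :: "int ^ 'd::finite \<Rightarrow> 'd torus \<Rightarrow> complex" is
  "\<lambda>n x. exp (2 * of_real pi * \<i> * of_real (inner (\<chi> i. real_of_int (vec_nth n i)) x))"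
proof -
  fix n :: "int ^ 'd" and x y :: "real ^ 'd"
  let ?n = "\<chi> i. real_of_int (vec_nth n i)"
  assume "\<And>i. vec_nth x i - vec_nth y i \<in> \<int>"
  then have "inner ?n (x - y) \<in> \<int>"
    by (auto simp: inner_vec_def)
  then obtain k where k: "inner ?n (x - y) = of_int k"
    by (auto elim: Ints_cases)
  then have "inner ?n x = inner ?n y + of_int k"
    by (simp add: inner_diff_right)
  then have "2 * of_real pi * \<i> * of_real (inner ?n x) =
      2 * of_real pi * \<i> * of_real (inner ?n y) + 2 * of_int k * of_real pi * \<i>"
    by (simp add: algebra_simps)
  then show "exp (2 * of_real pi * \<i> * of_real (inner ?n x)) =
      exp (2 * of_real pi * \<i> * complex_of_real (inner ?n y))"
    unfolding exp_eq by (intro exI[of _ k]) (simp add: algebra_simps)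
qed

section \<open>Quadrature\<close>

text \<open>Only meaningful for \<open>P\<close> consisting of integrable functions, because the
  integral of a non-integrable function is \<open>0\<close> by convention.\<close>

definition exact_quadrature ::
    "'a measure \<Rightarrow> 'a set \<Rightarrow> ('a \<Rightarrow> real) \<Rightarrow> ('a \<Rightarrow> complex) set \<Rightarrow> bool" where
  "exact_quadrature M X w P \<longleftrightarrow>
     (\<forall>f\<in>P. (\<Sum>x\<in>X. complex_of_real (w x) * f x) = (\<integral>x. f x \<partial>M))"

lemma integrable_torus_exp: "integrable torus_measure (torus_exp n)"
proof -
  interpret prob_space torus_measure by (rule prob_space_torus_measure)
  have "continuous_on UNIV (torus_exp n \<circ> abs_torus)"
    unfolding comp_def torus_exp.abs_eq by (intro continuous_intros)
  then have "continuous_on UNIV (torus_exp n)"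
    by (auto simp: continuous_on_open_vimage open_torus_def vimage_comp comp_def)
  then have "torus_exp n \<in> borel_measurable borel"
    by (rule borel_measurable_continuous_onI)
  then have "torus_exp n \<in> borel_measurable torus_measure"
    by (simp add: torus_measure_def)
  moreover have "norm (torus_exp n x) \<le> 1" for x
    by transfer (simp add: norm_exp_eq_Re)
  ultimately show ?thesis
    by (intro integrable_const_bound[of _ 1]) auto
qed

definition difference_set :: "(int ^ 'd) set \<Rightarrow> (int ^ 'd) set" where
  "difference_set I = {n1 - n2 |n1 n2. n1 \<in> I \<and> n2 \<in> I}"

section \<open>Matrices indexed by finite sets\<close>

text \<open>A matrix with rows indexed by a finite set \<open>X\<close> and columns by a finite set \<open>I\<close> is
  represented through repetition-free enumerations \<open>xs\<close> of \<open>X\<close> and \<open>ns\<close> of \<open>I\<close>: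
  row \<open>i\<close> belongs to \<open>xs ! i\<close> and column \<open>j\<close> to \<open>ns ! j\<close>.\<close>

definition weight_matrix :: "'a list \<Rightarrow> ('a \<Rightarrow> real) \<Rightarrow> complex mat" where
  "weight_matrix as w = mat_diag (length as) (\<lambda>i. complex_of_real (w (as ! i)))"

definition fourier_matrix :: "'d::finite torus list \<Rightarrow> (int ^ 'd) list \<Rightarrow> complex mat" where
  "fourier_matrix xs ns =
     Matrix.mat (length xs) (length ns) (\<lambda>(i, j). torus_exp (ns ! j) (xs ! i))"

definition system_matrix ::
    "'d::finite torus list \<Rightarrow> ('d torus \<Rightarrow> real) \<Rightarrow> (int ^ 'd) list \<Rightarrow> (int ^ 'd \<Rightarrow> real) \<Rightarrow> real
      \<Rightarrow> complex mat" where
  "system_matrix xs w ns w_hat lambda =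
     mat_adjoint (fourier_matrix xs ns) * weight_matrix xs w * fourier_matrix xs ns
       + complex_of_real lambda \<cdot>\<^sub>m weight_matrix ns w_hat"

text \<open>The value is meaningful only if the system matrix is invertible, i.e. if
  \<^const>\<open>mat_inverse\<close> does not return \<^const>\<open>None\<close>.\<close>

definition hat_matrix ::
    "'d::finite torus list \<Rightarrow> ('d torus \<Rightarrow> real) \<Rightarrow> (int ^ 'd) list \<Rightarrow> (int ^ 'd \<Rightarrow> real) \<Rightarrow> real
      \<Rightarrow> complex mat" where
  "hat_matrix xs w ns w_hat lambda =
     fourier_matrix xs ns * the (mat_inverse (system_matrix xs w ns w_hat lambda))
       * mat_adjoint (fourier_matrix xs ns) * weight_matrix xs w"

end

theory Submission
  imports Defs
begin

text \<open>
  Entry \<open>(m, n)\<close> of the Gram matrix \<open>F\<^sup>H W F\<close> is the quadrature sum of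
  \<open>e\<^sub>n \<cdot> cnj e\<^sub>m = e\<^bsub>n - m\<^esub>\<close>, where \<open>e\<^sub>n\<close> is the exponential with frequency
  \<open>n\<close>. Since \<open>n - m\<close> lies in the difference set, exactness turns this sum into the integral of
  \<open>e\<^bsub>n - m\<^esub>\<close> over the torus, which is \<open>1\<close> for \<open>m = n\<close> and \<open>0\<close> otherwise
  (\<open>integral_torus_exp\<close>). So the Gram matrix is the identity (\<open>gram_matrix_eq_one\<close>), the system
  matrix is diagonal with entries \<open>1 + \<lambda> w\<^sub>n > 0\<close>, and its inverse is obtained entrywise.
  The diagonal of the hat matrix then follows from \<open>\<bar>e\<^sub>n(x)\<bar> = 1\<close>: around a diagonal matrix
  \<open>V\<close>, entry \<open>(x, x)\<close> of \<open>F V F\<^sup>H\<close> is just the trace of \<open>V\<close>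
  (\<open>diagonal_fourier_sandwich\<close>).

  For the vanishing of the integral at \<open>n \<noteq> 0\<close>, choose a coordinate \<open>k\<close> with \<open>n\<^sub>k \<noteq> 0\<close>
  and translate by \<open>1 / (2 \<bar>n\<^sub>k\<bar>)\<close> along it. This half period reverses the sign of
  \<open>e\<^sub>n\<close>, whereas the integral of a periodic function over the unit cube is translation
  invariant (\<open>unit_cube_translate_periodic\<close>); so the integral equals its own negative.
\<close>

section \<open>Orthonormality of the trigonometric exponentials\<close>

lemma borel_measurable_torus_exp [measurable]: "torus_exp n \<in> borel_measurable borel"
  using borel_measurable_integrable[OF integrable_torus_exp[of n]]
  by (simp add: torus_measure_def)

lemma torus_exp_zero: "torus_exp 0 x = 1"
  by transfer (simp add: inner_vec_def)

lemma torus_exp_mult: "torus_exp m x * torus_exp n x = torus_exp (m + n) x"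
  by transfer (simp add: inner_vec_def exp_add [symmetric] sum.distrib distrib_left distrib_right)

lemma cnj_torus_exp: "cnj (torus_exp n x) = torus_exp (- n) x"
  by transfer (simp add: inner_vec_def exp_cnj sum_negf)

lemma norm_torus_exp: "norm (torus_exp n x) = 1"
  by transfer (simp add: norm_exp_eq_Re)

lemma torus_exp_translate:
  "torus_exp n (abs_torus (axis k t + x)) =
     exp (2 * of_real pi * \<i> * of_real (real_of_int (vec_nth n k) * t)) * torus_exp n (abs_torus x)"
  by (simp add: torus_exp.abs_eq inner_add_right inner_axis exp_add [symmetric] algebra_simps)

lemma integral_torus_measure:
  fixes f :: "'d::finite torus \<Rightarrow> complex"
  assumes [measurable]: "f \<in> borel_measurable borel"
  shows "(\<integral>x. f x \<partial>torus_measure) = (\<integral>x\<in>unit_cube. f (abs_torus x) \<partial>lborel)"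
proof -
  have "(\<integral>x. f x \<partial>torus_measure) = (\<integral>x. f (abs_torus x) \<partial>restrict_space lborel unit_cube)"
    unfolding torus_measure_def by (intro integral_distr measurable_restrict_space1) simp_all
  then show ?thesis
    by (simp add: integral_restrict_space set_lebesgue_integral_def)
qed

lemma integral_lborel_translate:
  fixes f :: "'a::euclidean_space \<Rightarrow> 'b::{banach, second_countable_topology}"
  assumes [measurable]: "f \<in> borel_measurable borel"
  shows "(\<integral>x. f (c + x) \<partial>lborel) = (\<integral>x. f x \<partial>lborel)"
proof -
  have "(\<integral>x. f x \<partial>lborel) = (\<integral>x. f x \<partial>distr lborel borel ((+) c))"
    by (simp add: lborel_distr_plus)
  also have "\<dots> = (\<integral>x. f (c + x) \<partial>lborel)"
    by (rule integral_distr) simp_all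
  finally show ?thesis ..
qed

text \<open>
  Translation moves the cube to \<open>[t, 1 + t)\<close> in direction \<open>k\<close>. The part beyond \<open>1\<close> is the
  slab \<open>[0, t)\<close> shifted by a full period, so by periodicity it can be put back where the cube
  has lost that slab.
\<close>
lemma unit_cube_translate_periodic:
  fixes f :: "real ^ 'd::finite \<Rightarrow> complex" and k :: 'd and t :: real
  assumes meas [measurable]: "f \<in> borel_measurable borel"
    and bounded: "\<And>x. norm (f x) \<le> B"
    and periodic: "\<And>x. f (axis k 1 + x) = f x"
    and t: "0 \<le> t" "t \<le> 1"
  shows "(\<integral>x\<in>unit_cube. f (axis k t + x) \<partial>lborel) = (\<integral>x\<in>unit_cube. f x \<partial>lborel)"
proof -
  define D where "D = {x \<in> unit_cube. vec_nth x k < t}"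
  define E where "E = {x \<in> unit_cube. t \<le> vec_nth x k}"
  have "D = unit_cube \<inter> {x. vec_nth x k < t}" "E = unit_cube \<inter> {x. t \<le> vec_nth x k}"
    by (auto simp: D_def E_def)
  moreover have "open {x :: real ^ 'd. vec_nth x k < t}" "closed {x :: real ^ 'd. t \<le> vec_nth x k}"
    by (intro open_Collect_less closed_Collect_le continuous_intros)+
  ultimately have D [measurable]: "D \<in> sets borel" and E [measurable]: "E \<in> sets borel"
    by auto
  have "emeasure lborel S < \<infinity>" if "S \<subseteq> (unit_cube :: (real ^ 'd) set)" for S
  proof -
    have "emeasure lborel S \<le> 1"
      using emeasure_mono[OF that, of lborel] by (simp add: emeasure_unit_cube)
    then show ?thesis
      using order.strict_trans1 by fastforce
  qed
  then have fin: "emeasure lborel D < \<infinity>" "emeasure lborel E < \<infinity>"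
    by (auto simp: D_def E_def)
  have int: "set_integrable lborel S f" if "S \<in> sets borel" "emeasure lborel S < \<infinity>" for S
    unfolding set_integrable_def
    by (rule integrableI_bounded_set[where A = S and B = B])
      (use that bounded in \<open>auto simp: indicator_def\<close>)
  let ?e = "axis k 1 :: real ^ 'd" and ?t = "axis k t :: real ^ 'd"
  have shifted: "(\<integral>x. indicator D (- ?e + x) *\<^sub>R f x \<partial>lborel) = (\<integral>x\<in>D. f x \<partial>lborel)"
    using integral_lborel_translate[of "\<lambda>x. indicator D (- ?e + x) *\<^sub>R f x" ?e]
    by (simp add: periodic set_lebesgue_integral_def)
  have int_shifted: "integrable lborel (\<lambda>x. indicator D (- ?e + x) *\<^sub>R f x)"
  proof -
    have "integrable (distr lborel borel ((+) ?e)) (\<lambda>x. indicator D (- ?e + x) *\<^sub>R f x)"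
      using int[OF D fin(1)] by (subst integrable_distr_eq) (simp_all add: periodic set_integrable_def)
    then show ?thesis
      by (simp add: lborel_distr_plus)
  qed
  \<comment> \<open>The translated cube is the remaining part \<open>E\<close> together with the cut-off slab \<open>D\<close>,
    moved by one period.\<close>
  have wrap: "indicator unit_cube (- ?t + x) = (indicator E x + indicator D (- ?e + x) :: real)" for x
  proof -
    have other: "vec_nth (axis k s) i = 0" if "i \<noteq> k" for i and s :: real
      using that by (simp add: axis_def)
    have cube: "y \<in> unit_cube \<longleftrightarrow> 0 \<le> vec_nth y k \<and> vec_nth y k < 1 \<and>
        (\<forall>i. i \<noteq> k \<longrightarrow> 0 \<le> vec_nth y i \<and> vec_nth y i < 1)" for y :: "real ^ 'd"
      unfolding unit_cube_def by (simp, metis)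
    show ?thesis
      using t by (auto simp: indicator_def D_def E_def cube other)
  qed
  have "(\<integral>x\<in>unit_cube. f (?t + x) \<partial>lborel) = (\<integral>x. indicator unit_cube (- ?t + x) *\<^sub>R f x \<partial>lborel)"
    using integral_lborel_translate[of "\<lambda>x. indicator unit_cube (- ?t + x) *\<^sub>R f x" ?t]
    by (simp add: set_lebesgue_integral_def)
  also have "\<dots> = (\<integral>x\<in>E. f x \<partial>lborel) + (\<integral>x\<in>D. f x \<partial>lborel)"
    using int[OF E fin(2)] int_shifted shifted unfolding wrap
    by (simp add: scaleR_add_left set_integrable_def set_lebesgue_integral_def)
  also have "\<dots> = (\<integral>x\<in>E \<union> D. f x \<partial>lborel)"
    by (rule set_integral_Un [symmetric]) (use int fin in \<open>auto simp: D_def E_def\<close>)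
  also have "E \<union> D = unit_cube"
    by (auto simp: D_def E_def)
  finally show ?thesis .
qed

text \<open>
  For \<open>n \<noteq> 0\<close>, translation by half a period in a coordinate that occurs in \<open>n\<close> shows that
  the integral equals its own negative.
\<close>
lemma integral_torus_exp:
  fixes n :: "int ^ 'd::finite"
  shows "(\<integral>x. torus_exp n x \<partial>torus_measure) = (if n = 0 then 1 else 0)"
proof (cases "n = 0")
  case True
  interpret prob_space "torus_measure :: 'd torus measure"
    by (rule prob_space_torus_measure)
  from True show ?thesis
    by (simp add: torus_exp_zero prob_space)
next
  case False
  then obtain k where k: "vec_nth n k \<noteq> 0"
    by (auto simp: Finite_Cartesian_Product.vec_eq_iff)
  define t where "t = 1 / (2 * \<bar>real_of_int (vec_nth n k)\<bar>)"
  have "1 \<le> \<bar>real_of_int (vec_nth n k)\<bar>"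
    using k by linarith
  then have t: "0 \<le> t" "t \<le> 1"
    by (simp_all add: t_def divide_simps)
  have half: "real_of_int (vec_nth n k) * t = 1/2 \<or> real_of_int (vec_nth n k) * t = - (1/2)"
    using k by (auto simp: t_def abs_if)
  have flip: "torus_exp n (abs_torus (axis k t + x)) = - torus_exp n (abs_torus x)" for x
  proof -
    have "exp (2 * of_real pi * \<i> * of_real (real_of_int (vec_nth n k) * t)) = - 1"
      using half by (elim disjE) (simp_all only:, simp_all add: exp_minus)
    then show ?thesis
      unfolding torus_exp_translate by simp
  qed
  have period: "torus_exp n (abs_torus (axis k 1 + x)) = torus_exp n (abs_torus x)" for x
    using exp_2pi_1_int[of "vec_nth n k"]
    unfolding torus_exp_translate by (simp add: mult_ac)
  let ?J = "\<integral>x\<in>unit_cube. torus_exp n (abs_torus x) \<partial>lborel"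
  have "?J = (\<integral>x\<in>unit_cube. torus_exp n (abs_torus (axis k t + x)) \<partial>lborel)"
    by (rule unit_cube_translate_periodic[symmetric, where B = 1])
      (use t period in \<open>simp_all add: norm_torus_exp\<close>)
  also have "\<dots> = - ?J"
    by (simp add: flip set_lebesgue_integral_def)
  finally have "?J = 0"
    by simp
  with False show ?thesis
    by (simp add: integral_torus_measure)
qed

section \<open>The system matrix and the hat matrix\<close>

lemma weight_matrix_carrier [simp]: "weight_matrix as w \<in> carrier_mat (length as) (length as)"
  by (simp add: weight_matrix_def)

lemma fourier_matrix_carrier [simp]:
  "fourier_matrix xs ns \<in> carrier_mat (length xs) (length ns)"
  by (simp add: fourier_matrix_def)

lemma adjoint_fourier_matrix:
  "mat_adjoint (fourier_matrix xs ns) =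
     Matrix.mat (length ns) (length xs) (\<lambda>(j, i). torus_exp (- (ns ! j)) (xs ! i))"
  by (rule eq_matI)
    (auto simp: mat_adjoint_def mat_of_rows_def fourier_matrix_def cnj_torus_exp)

text \<open>
  \<^const>\<open>mat_inverse\<close> is computed by Gauss-Jordan elimination; uniqueness of inverses lets any
  known inverse stand for its result.
\<close>
lemma mat_inverse_eq_SomeI:
  fixes A :: "'a::field mat"
  assumes A: "A \<in> carrier_mat n n" and B: "B \<in> carrier_mat n n"
    and BA: "B * A = 1\<^sub>m n" and AB: "A * B = 1\<^sub>m n"
  shows "mat_inverse A = Some B"
proof (cases "mat_inverse A")
  case None
  have "A \<in> Units (ring_mat TYPE('a) n ())"
    using assms by (auto simp: Units_def ring_mat_def)
  with mat_inverse(1)[OF A None, of "()"] show ?thesis by simp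
next
  case (Some C)
  note C = mat_inverse(2)[OF A Some]
  have "C = (B * A) * C"
    using C BA by auto
  also have "\<dots> = B * (A * C)"
    using A B C by (intro assoc_mult_mat) auto
  also have "\<dots> = B"
    using B C by auto
  finally have "C = B" .
  with Some show ?thesis by simp
qed

text \<open>
  Exactness on the difference set says precisely that the quadrature sums reproduce all inner
  products between exponentials with frequencies in \<open>ns\<close>, so these stay orthonormal for the discrete
  inner product.
\<close>
lemma gram_matrix_eq_one:
  assumes exact: "exact_quadrature torus_measure (set xs) w (torus_exp ` difference_set (set ns))"
    and xs: "distinct xs" and ns: "distinct ns"
  shows "mat_adjoint (fourier_matrix xs ns) * weight_matrix xs w * fourier_matrix xs ns =
    1\<^sub>m (length ns)"
proof (rule eq_matI)
  fix i j assume ij: "i < dim_row (1\<^sub>m (length ns) :: complex mat)"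
    "j < dim_col (1\<^sub>m (length ns) :: complex mat)"
  have diff: "ns ! j - ns ! i \<in> difference_set (set ns)"
    using ij nth_mem[of i ns] nth_mem[of j ns] unfolding difference_set_def by fastforce
  have "(mat_adjoint (fourier_matrix xs ns) * weight_matrix xs w * fourier_matrix xs ns) $$ (i, j) =
      (\<Sum>k<length xs. w (xs ! k) * (torus_exp (- (ns ! i)) (xs ! k) * torus_exp (ns ! j) (xs ! k)))"
    using ij unfolding adjoint_fourier_matrix unfolding weight_matrix_def fourier_matrix_def
    by (subst mat_diag_mult_right[of _ "length ns"])
      (auto simp: scalar_prod_def lessThan_atLeast0 mult_ac intro!: sum.cong)
  also have "\<dots> = (\<Sum>x\<in>set xs. w x * torus_exp (ns ! j - ns ! i) x)"
    using xs by (simp add: torus_exp_mult sum_list_distinct_conv_sum_set [symmetric]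
        sum_list_sum_nth lessThan_atLeast0)
  also have "\<dots> = (\<integral>x. torus_exp (ns ! j - ns ! i) x \<partial>torus_measure)"
    using exact diff by (simp add: exact_quadrature_def)
  also have "\<dots> = (1\<^sub>m (length ns) :: complex mat) $$ (i, j)"
    using ij ns by (simp add: integral_torus_exp nth_eq_iff_index_eq)
  finally show "(mat_adjoint (fourier_matrix xs ns) * weight_matrix xs w * fourier_matrix xs ns) $$ (i, j) =
    (1\<^sub>m (length ns) :: complex mat) $$ (i, j)" .
qed (simp_all add: adjoint_fourier_matrix, simp add: fourier_matrix_def)

lemma system_matrix_eq_weight_matrix:
  assumes "exact_quadrature torus_measure (set xs) w (torus_exp ` difference_set (set ns))"
    and "distinct xs" and "distinct ns"
  shows "system_matrix xs w ns w_hat lambda = weight_matrix ns (\<lambda>n. 1 + lambda * w_hat n)"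
  unfolding system_matrix_def gram_matrix_eq_one[OF assms]
  by (rule eq_matI) (auto simp: weight_matrix_def mat_diag_def)

lemma mat_inverse_weight_matrix:
  assumes "\<And>a. a \<in> set as \<Longrightarrow> w a \<noteq> 0"
  shows "mat_inverse (weight_matrix as w) = Some (weight_matrix as (\<lambda>a. 1 / w a))"
proof -
  have "mat_diag (length as) (\<lambda>i. complex_of_real (w (as ! i)) * complex_of_real (1 / w (as ! i))) =
      1\<^sub>m (length as)"
    unfolding mat_diag_def by (rule eq_matI) (use assms in auto)
  then show ?thesis
    by (intro mat_inverse_eq_SomeI[where n = "length as"]) (simp_all add: weight_matrix_def mult.commute)
qed

text \<open>
  All entries of the Fourier matrix have modulus \<open>1\<close>, so every node sees the same value,
  the trace of the diagonal matrix in the middle; only the last factor depends on the node.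
\<close>
lemma diagonal_fourier_sandwich:
  assumes i: "i < length xs"
  shows "(fourier_matrix xs ns * weight_matrix ns v * mat_adjoint (fourier_matrix xs ns) *
      weight_matrix xs w) $$ (i, i) = complex_of_real (w (xs ! i) * (\<Sum>n\<leftarrow>ns. v n))"
proof -
  have one: "torus_exp n x * torus_exp (- n) x = 1" for n :: "int ^ 'a" and x
    by (simp add: torus_exp_mult torus_exp_zero)
  let ?F = "fourier_matrix xs ns"
  let ?M = "?F * weight_matrix ns v * mat_adjoint ?F"
  have FV: "?F * weight_matrix ns v =
      Matrix.mat (length xs) (length ns) (\<lambda>(i, j). torus_exp (ns ! j) (xs ! i) * v (ns ! j))"
    unfolding weight_matrix_def mat_diag_mult_right[OF fourier_matrix_carrier]
    by (rule eq_matI) (auto simp: fourier_matrix_def)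
  have "?M $$ (i, i) =
      (\<Sum>j<length ns. torus_exp (ns ! j) (xs ! i) * v (ns ! j) * torus_exp (- (ns ! j)) (xs ! i))"
    using i unfolding FV adjoint_fourier_matrix by (simp add: scalar_prod_def lessThan_atLeast0)
  also have "\<dots> = (\<Sum>j<length ns. v (ns ! j) * (torus_exp (ns ! j) (xs ! i) * torus_exp (- (ns ! j)) (xs ! i)))"
    by (simp only: mult_ac)
  also have "\<dots> = complex_of_real (\<Sum>n\<leftarrow>ns. v n)"
    unfolding one by (simp add: sum_list_sum_nth lessThan_atLeast0)
  finally have diag: "?M $$ (i, i) = complex_of_real (\<Sum>n\<leftarrow>ns. v n)" .
  have "?M \<in> carrier_mat (length xs) (length xs)"
    unfolding FV adjoint_fourier_matrix by (rule mult_carrier_mat[of _ _ "length ns"]) simp_all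
  then show ?thesis
    using i diag unfolding weight_matrix_def[of xs w] by (simp add: mat_diag_mult_right)
qed

theorem theorem3p2:
  fixes lambda :: real
    and I :: "(int ^ 'd::finite) set" and w_hat :: "int ^ 'd \<Rightarrow> real"
    and X :: "'d torus set" and w :: "'d torus \<Rightarrow> real"
    and ns :: "(int ^ 'd) list" and xs :: "'d torus list"
  assumes "lambda > 0"
    and "finite I" and "\<And>n. n \<in> I \<Longrightarrow> w_hat n > 0"
    and "finite X" and "\<And>x. x \<in> X \<Longrightarrow> w x > 0"
    and "exact_quadrature torus_measure X w (torus_exp ` difference_set I)"
    and "distinct ns" and "set ns = I"
    and "distinct xs" and "set xs = X"
  shows "mat_inverse (system_matrix xs w ns w_hat lambda) =
           Some (weight_matrix ns (\<lambda>n. 1 / (1 + lambda * w_hat n)))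
       \<and> (\<forall>i < length xs. hat_matrix xs w ns w_hat lambda $$ (i, i) =
           complex_of_real (w (xs ! i) * (\<Sum>n\<in>I. 1 / (1 + lambda * w_hat n))))"
proof -
  have nonzero: "1 + lambda * w_hat n \<noteq> 0" if "n \<in> set ns" for n
    using mult_pos_pos[OF \<open>lambda > 0\<close> assms(3)[of n]] that \<open>set ns = I\<close> by simp
  have "system_matrix xs w ns w_hat lambda = weight_matrix ns (\<lambda>n. 1 + lambda * w_hat n)"
    using assms by (intro system_matrix_eq_weight_matrix) auto
  then have inverse: "mat_inverse (system_matrix xs w ns w_hat lambda) =
      Some (weight_matrix ns (\<lambda>n. 1 / (1 + lambda * w_hat n)))"
    using mat_inverse_weight_matrix[OF nonzero] by simp
  have "(\<Sum>n\<leftarrow>ns. 1 / (1 + lambda * w_hat n)) = (\<Sum>n\<in>I. 1 / (1 + lambda * w_hat n))"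
    using \<open>distinct ns\<close> \<open>set ns = I\<close> by (simp add: sum_list_distinct_conv_sum_set)
  with inverse show ?thesis
    by (simp add: hat_matrix_def diagonal_fourier_sandwich)
qed

end
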